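(* Let $n\ge 1$, $\mathbf{w}\in\mathbb{R}^n_{++}$, $W=\sum_{b=1}^n w_b$, $q>0$, $P\ge 0$, $R_A\ge 0$, $R_B>0$, and consider the two-stage game described in the context. Then: (i) The pre-allocation $\mathbf{p}^*=\frac{P}{W}\mathbf{w}$ maximizes $\pi_A(\mathbf{p},R_A,R_B)$ over $\mathbf{p}\in\Delta_n(P)$. (ii) The resulting equilibrium payoff $\pi_A^*(P,R_A,R_B):=\max_{\mathbf{p}\in\Delta_n(P)}\pi_A(\mathbf{p},R_A,R_B)$ is as follows. - If $qR_B>P$ and $R_A<\dfrac{2(qR_B-P)^2}{P+2(qR_B-P)}$, then $$\pi_A^*(P,R_A,R_B)=W\cdot\frac{R_A}{2(qR_B-P)}.$$ - Otherwise, that is, if $qR_B\le P$, or if $qR_B>P$ and $R_A\ge \dfrac{2(qR_B-P)^2}{P+2(qR_B-P)}$, then $$\pi_A^*(P,R_A,R_B)=W\left(1-\frac{qR_B}{P+R_A+\sqrt{(R_A+P)^2-P^2}}\right).$$ Player $B$'s equilibrium payoff is $W-\pi_A^*(P,R_A,R_B)$.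
   Context: **Battlefields.** There are $n$ battlefields $\mathcal{B}=\{1,\dots,n\}$. Battlefield $b$ has value $w_b>0$, common to both players, and $W=\sum_b w_b$. **Endowments.** Player $A$ has $P\ge 0$ pre-allocated resources and $R_A\ge 0$ real-time resources. Player $B$ has $R_B>0$ real-time resources. The constant $q>0$ is the effectiveness of $B$'s resources relative to $A$'s. **Stage 1.** Player $A$ deterministically chooses a pre-allocation $$\mathbf{p}\in\Delta_n(P):=\Big\{\mathbf{p}\in\mathbb{R}^n_+:\ \textstyle\sum_b p_b=P\Big\}.$$ This choice is binding and revealed to $B$. **Stage 2 (General Lotto game with favoritism).** Each player $i\in\{A,B\}$ simultaneously chooses a strategy, which is any probability distribution $F_i$ over allocations $\mathbf{x}_i\in\mathbb{R}^n_+$ satisfying the budget constraint in expectation: $$\mathbb{E}_{\mathbf{x}_i\sim F_i}\Big[\textstyle\sum_b x_{i,b}\Big]\le R_i.$$ Player $A$ wins battlefield $b$ if $x_{A,b}+p_b>q\,x_{B,b}$; otherwise $B$ wins it. The tie-breaking rule is arbitrary. Player $A$'s payoff is the expected total value of the battlefields it wins, and $B$'s payoff is $W$ minus this. **Equilibrium payoff.** This stage-2 game always has a Nash equilibrium, and the equilibrium payoffs are unique. The unique equilibrium payoff to $A$ for fixed $\mathbf{p}$ is denoted $\pi_A(\mathbf{p},R_A,R_B)$. *)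

theory Defs
  imports "HOL-Probability.Probability"
begin

text \<open>Battlefields are the elements of a finite (nonempty) index type 'n;
allocations are vectors in real^'n.\<close>

definition pre_simplex :: "real \<Rightarrow> (real^'n::finite) set" where
  "pre_simplex P = {p. (\<forall>b. 0 \<le> p $ b) \<and> (\<Sum>b\<in>UNIV. p $ b) = P}"

definition lotto_strategy :: "real \<Rightarrow> (real^'n::finite) measure \<Rightarrow> bool" where
  "lotto_strategy R F \<longleftrightarrow>
     prob_space F \<and> sets F = sets borel \<and>
     (AE x in F. \<forall>b. 0 \<le> x $ b) \<and>
     (\<integral>\<^sup>+ x. ennreal (\<Sum>b\<in>UNIV. x $ b) \<partial>F) \<le> ennreal R"

definition payoffA :: "real \<Rightarrow> real^'n \<Rightarrow> real^'n \<Rightarrow> (real^'n::finite) measure \<Rightarrow> (real^'n) measure \<Rightarrow> real" where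
  "payoffA q w p FA FB =
     (\<Sum>b\<in>UNIV. w $ b *
        measure (FA \<Otimes>\<^sub>M FB) {z \<in> space (FA \<Otimes>\<^sub>M FB). fst z $ b + p $ b > q * snd z $ b})"

text \<open>Nash equilibrium of the stage-2 (constant-sum) game: B's payoff is W minus A's payoff,
so B maximizing its payoff is B minimizing A's payoff.\<close>
definition lotto_NE :: "real \<Rightarrow> real^'n \<Rightarrow> real^'n \<Rightarrow> real \<Rightarrow> real \<Rightarrow>
    (real^'n::finite) measure \<Rightarrow> (real^'n) measure \<Rightarrow> bool" where
  "lotto_NE q w p RA RB FA FB \<longleftrightarrow>
     lotto_strategy RA FA \<and> lotto_strategy RB FB \<and>
     (\<forall>FA'. lotto_strategy RA FA' \<longrightarrow> payoffA q w p FA' FB \<le> payoffA q w p FA FB) \<and>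
     (\<forall>FB'. lotto_strategy RB FB' \<longrightarrow> payoffA q w p FA FB \<le> payoffA q w p FA FB')"

definition piA :: "real \<Rightarrow> real^'n \<Rightarrow> real^'n \<Rightarrow> real \<Rightarrow> real \<Rightarrow> real" where
  "piA q w p RA RB = (THE v. \<exists>FA FB::(real^'n::finite) measure.
       lotto_NE q w p RA RB FA FB \<and> payoffA q w p FA FB = v)"

definition piA_star :: "real \<Rightarrow> real^'n \<Rightarrow> real \<Rightarrow> real \<Rightarrow> real \<Rightarrow> real" where
  "piA_star q w P RA RB = (SUP p \<in> (pre_simplex P :: (real^'n::finite) set). piA q w p RA RB)"

end

theory Submission
  imports Defs
begin

text \<open>On each battlefield let B bid \<open>0\<close> with probability \<open>1 - \<theta> b\<close> and otherwise uniformly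
above \<open>p $ b / q\<close> with density proportional to \<open>u / w $ b\<close>. Against this A wins battlefield
\<open>b\<close> with probability at most \<open>1 - \<theta> b + x $ b * u / w $ b\<close>, so A gets at most
\<open>(\<Sum>b. w $ b * (1 - \<theta> b)) + RA * u\<close>. For suitable \<open>\<theta>\<close> and \<open>u\<close> a similar randomisation of A
guarantees the same amount, which gives an equilibrium for every pre-allocation. For the
proportional pre-allocation the equilibrium \<open>\<theta>\<close> is constant. The cost to B of a constant
\<open>\<theta>\<close> depends on \<open>p\<close> only through \<open>P\<close>, so B can use that same strategy against any
pre-allocation, and none is better for A than the proportional one.\<close>

subsection \<open>Marginal bounds on payoffs\<close>

text \<open>Fubini carries a bound on sections to the product measure. As \<open>f\<close> dominates
  a measure, it is nonnegative almost everywhere, so the bound is a genuine expectation, to which a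
  budget applies.\<close>

lemma pair_measure_le_integral:
  assumes "prob_space M" "prob_space N" and X: "X \<in> sets (M \<Otimes>\<^sub>M N)" and f: "integrable M f"
    and le: "AE x in M. measure N (Pair x -` X) \<le> f x"
  shows "measure (M \<Otimes>\<^sub>M N) X \<le> integral\<^sup>L M f"
proof -
  interpret M: prob_space M by fact
  interpret N: prob_space N by fact
  interpret P: pair_prob_space M N ..
  have nonneg: "AE x in M. 0 \<le> f x"
    using le by eventually_elim (meson measure_nonneg order_trans)
  have "ennreal (measure (M \<Otimes>\<^sub>M N) X) = (\<integral>\<^sup>+ x. ennreal (measure N (Pair x -` X)) \<partial>M)"
    using N.emeasure_pair_measure_alt[OF X]
    by (simp add: P.emeasure_eq_measure N.emeasure_eq_measure)
  also have "\<dots> \<le> (\<integral>\<^sup>+ x. ennreal (f x) \<partial>M)"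
    using le by (intro nn_integral_mono_AE) (auto intro: ennreal_leI)
  also have "\<dots> = ennreal (integral\<^sup>L M f)"
    using f nonneg by (rule nn_integral_eq_integral)
  finally show ?thesis
    using integral_nonneg_AE[OF nonneg] by (simp add: ennreal_le_iff)
qed

lemma pair_measure_le_integral':
  assumes "prob_space M" "prob_space N" and X: "X \<in> sets (M \<Otimes>\<^sub>M N)" and f: "integrable N f"
    and le: "AE y in N. measure M ((\<lambda>x. (x, y)) -` X) \<le> f y"
  shows "measure (M \<Otimes>\<^sub>M N) X \<le> integral\<^sup>L N f"
proof -
  interpret M: prob_space M by fact
  interpret N: prob_space N by fact
  interpret P: pair_prob_space M N ..
  have nonneg: "AE x in N. 0 \<le> f x"
    using le by eventually_elim (meson measure_nonneg order_trans)
  have "ennreal (measure (M \<Otimes>\<^sub>M N) X) = (\<integral>\<^sup>+ y. ennreal (measure M ((\<lambda>x. (x, y)) -` X)) \<partial>N)"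
    using P.emeasure_pair_measure_alt2[OF X]
    by (simp add: P.emeasure_eq_measure M.emeasure_eq_measure)
  also have "\<dots> \<le> (\<integral>\<^sup>+ x. ennreal (f x) \<partial>N)"
    using le by (intro nn_integral_mono_AE) (auto intro: ennreal_leI)
  also have "\<dots> = ennreal (integral\<^sup>L N f)"
    using f nonneg by (rule nn_integral_eq_integral)
  finally show ?thesis
    using integral_nonneg_AE[OF nonneg] by (simp add: ennreal_le_iff)
qed

lemma lotto_strategyD:
  assumes "lotto_strategy R F"
  shows "prob_space F" "sets F = sets borel" "space F = UNIV" "AE x in F. \<forall>b. 0 \<le> x $ b"
  using assms sets_eq_imp_space_eq[of F borel] by (auto simp: lotto_strategy_def)

text \<open>Each coordinate is almost surely dominated by the sum of all, so the extended-valued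
  budget becomes a linear inequality between real expectations.\<close>

lemma lotto_strategy_mean:
  fixes F :: "(real^'n::finite) measure"
  assumes F: "lotto_strategy R F" and R: "0 \<le> R"
  shows "integrable F (\<lambda>x. x $ b)" "(\<Sum>b\<in>UNIV. \<integral>x. x $ b \<partial>F) \<le> R"
proof -
  note D = lotto_strategyD[OF F]
  have [measurable_cong]: "sets F = sets borel" by fact
  have le: "(\<integral>\<^sup>+ x. ennreal (\<Sum>b\<in>UNIV. x $ b) \<partial>F) \<le> ennreal R"
    using F by (simp add: lotto_strategy_def)
  have nn: "AE x in F. 0 \<le> (\<Sum>b\<in>UNIV. x $ b)"
    using D(4) by eventually_elim (auto intro: sum_nonneg)
  have int: "integrable F (\<lambda>x. \<Sum>b\<in>UNIV. x $ b)"
    using nn le by (intro integrableI_nonneg) (auto intro: le_less_trans)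
  show int_b: "integrable F (\<lambda>x. x $ b)" for b
  proof (rule Bochner_Integration.integrable_bound[OF int])
    show "AE x in F. norm (x $ b) \<le> norm (\<Sum>b\<in>UNIV. x $ b)"
      using D(4)
    proof eventually_elim
      case (elim x)
      then have "x $ b \<le> (\<Sum>b\<in>UNIV. x $ b)"
        by (intro member_le_sum) auto
      with elim show ?case by auto
    qed
  qed simp
  have "ennreal (\<integral>x. (\<Sum>b\<in>UNIV. x $ b) \<partial>F) \<le> ennreal R"
    using le nn_integral_eq_integral[OF int nn] by simp
  then show "(\<Sum>b\<in>UNIV. \<integral>x. x $ b \<partial>F) \<le> R"
    using int_b R by (simp add: ennreal_le_iff)
qed

lemma measurable_vec_nth_compose [measurable (raw)]:
  fixes f :: "'a \<Rightarrow> real^'n::finite"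
  assumes "f \<in> borel_measurable M"
  shows "(\<lambda>x. f x $ i) \<in> borel_measurable M"
  using assms borel_measurable_nth by (rule measurable_compose)

lemma sets_win:
  fixes FA FB :: "(real^'n::finite) measure"
  assumes [measurable_cong]: "sets FA = sets borel" "sets FB = sets borel"
  shows "{z \<in> space (FA \<Otimes>\<^sub>M FB). fst z $ b + p > q * snd z $ b} \<in> sets (FA \<Otimes>\<^sub>M FB)"
  by measurable

lemma payoffA_le:
  fixes FA FB :: "(real^'n::finite) measure"
  assumes w: "\<forall>b. 0 < w $ b" and A: "lotto_strategy RA FA" and B: "lotto_strategy RB FB"
    and int: "\<And>b. integrable FA (f b)"
    and le: "\<And>b. AE x in FA. measure FB {y. x $ b + p $ b > q * y $ b} \<le> f b x"
  shows "payoffA q w p FA FB \<le> (\<Sum>b\<in>UNIV. w $ b * (\<integral>x. f b x \<partial>FA))"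
  unfolding payoffA_def
proof (intro sum_mono mult_left_mono)
  fix b :: 'n
  note DA = lotto_strategyD[OF A] and DB = lotto_strategyD[OF B]
  let ?X = "{z \<in> space (FA \<Otimes>\<^sub>M FB). fst z $ b + p $ b > q * snd z $ b}"
  have eq: "Pair x -` ?X = {y. x $ b + p $ b > q * y $ b}" for x
    by (auto simp: space_pair_measure DA DB)
  show "measure (FA \<Otimes>\<^sub>M FB) ?X \<le> (\<integral>x. f b x \<partial>FA)"
    by (intro pair_measure_le_integral DA(1) DB(1) sets_win DA(2) DB(2) int) (unfold eq, rule le)
  show "0 \<le> w $ b" using w by (simp add: less_imp_le)
qed

text \<open>The section bound concerns the complementary event that B wins, which includes ties:
  hence \<open>\<le>\<close> in the event and \<open>1 -\<close> in the conclusion.\<close>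

lemma payoffA_ge:
  fixes FA FB :: "(real^'n::finite) measure"
  assumes w: "\<forall>b. 0 < w $ b" and A: "lotto_strategy RA FA" and B: "lotto_strategy RB FB"
    and int: "\<And>b. integrable FB (f b)"
    and le: "\<And>b. AE y in FB. measure FA {x. x $ b + p $ b \<le> q * y $ b} \<le> f b y"
  shows "(\<Sum>b\<in>UNIV. w $ b * (1 - (\<integral>y. f b y \<partial>FB))) \<le> payoffA q w p FA FB"
  unfolding payoffA_def
proof (intro sum_mono mult_left_mono)
  fix b :: 'n
  note DA = lotto_strategyD[OF A] and DB = lotto_strategyD[OF B]
  interpret A: prob_space FA by fact
  interpret B: prob_space FB by fact
  interpret P: pair_prob_space FA FB ..
  let ?S = "space (FA \<Otimes>\<^sub>M FB)"
  let ?X = "{z \<in> ?S. fst z $ b + p $ b > q * snd z $ b}"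
  have X: "?X \<in> sets (FA \<Otimes>\<^sub>M FB)"
    using DA(2) DB(2) by (rule sets_win)
  have eq: "(\<lambda>x. (x, y)) -` (?S - ?X) = {x. x $ b + p $ b \<le> q * y $ b}" for y
    by (auto simp: space_pair_measure DA DB)
  have "measure (FA \<Otimes>\<^sub>M FB) (?S - ?X) \<le> (\<integral>y. f b y \<partial>FB)"
    by (intro pair_measure_le_integral' DA(1) DB(1) int sets.compl_sets X) (unfold eq, rule le)
  then show "1 - (\<integral>y. f b y \<partial>FB) \<le> measure (FA \<Otimes>\<^sub>M FB) ?X"
    using P.prob_compl[OF X] by simp
  show "0 \<le> w $ b" using w by (simp add: less_imp_le)
qed

section \<open>Strategies driven by one uniform variable\<close>

text \<open>Payoffs depend only on the one-dimensional marginals, so a single uniform variable may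
drive all coordinates: coordinate \<open>b\<close> is uniform on \<open>[a b, a b + c b * k b]\<close> with
probability \<open>k b\<close> and \<open>0\<close> otherwise.\<close>

abbreviation unit_uniform :: "real measure" where
  "unit_uniform \<equiv> uniform_measure lborel {0..1}"

definition ramp :: "('n \<Rightarrow> real) \<Rightarrow> ('n \<Rightarrow> real) \<Rightarrow> ('n \<Rightarrow> real) \<Rightarrow> real \<Rightarrow> real^'n::finite" where
  "ramp a c k s = (\<chi> b. if s \<le> k b then a b + c b * s else 0)"

definition ramp_strategy :: "('n \<Rightarrow> real) \<Rightarrow> ('n \<Rightarrow> real) \<Rightarrow> ('n \<Rightarrow> real) \<Rightarrow> (real^'n::finite) measure" where
  "ramp_strategy a c k = distr unit_uniform borel (ramp a c k)"

lemma prob_space_unit_uniform: "prob_space unit_uniform"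
  by (rule prob_space_uniform_measure) auto

lemma borel_measurable_ramp: "ramp a c k \<in> borel_measurable borel"
  unfolding ramp_def
  by (subst borel_measurable_euclidean_space) (auto simp: Basis_vec_def inner_axis)

lemma measurable_ramp [measurable]: "ramp a c k \<in> borel_measurable unit_uniform"
  using borel_measurable_ramp by (subst measurable_cong_sets[where M' = borel and N' = borel]) auto

lemma lotto_strategy_ramp:
  fixes a c k :: "'n::finite \<Rightarrow> real"
  assumes k: "\<And>b. 0 \<le> k b" "\<And>b. k b \<le> 1" and a: "\<And>b. 0 \<le> a b" and c: "\<And>b. 0 \<le> c b"
    and budget: "(\<Sum>b\<in>UNIV. a b * k b + c b * (k b)\<^sup>2 / 2) \<le> R"
  shows "lotto_strategy R (ramp_strategy a c k)"
proof -
  interpret prob_space unit_uniform by (rule prob_space_unit_uniform)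
  let ?g = "\<lambda>b s. (a b + c b * s) * indicator {0..k b} s"
  have int: "(?g b has_integral (a b * k b + c b * (k b)\<^sup>2 / 2)) UNIV" for b
  proof -
    have "((\<lambda>s. a b + c b * s) has_integral
        ((a b * k b + c b * (k b)\<^sup>2 / 2) - (a b * 0 + c b * 0\<^sup>2 / 2))) {0..k b}"
      using k(1) by (intro fundamental_theorem_of_calculus)
        (auto intro!: derivative_eq_intros simp flip: has_real_derivative_iff_has_vector_derivative)
    then have "((\<lambda>s. if s \<in> {0..k b} then a b + c b * s else 0) has_integral
        (a b * k b + c b * (k b)\<^sup>2 / 2)) UNIV"
      by (subst has_integral_restrict_UNIV) simp
    then show ?thesis
      by (rule has_integral_eq[rotated]) (auto simp: indicator_def)
  qed
  have nn: "0 \<le> ?g b s" for b s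
    using a c by (auto simp: indicator_def)
  have g: "indicator {0..1} s * ramp a c k s $ b = ?g b s" for b s
    using k(2)[of b] by (auto simp: ramp_def indicator_def)
  have "(\<integral>\<^sup>+ x. ennreal (\<Sum>b\<in>UNIV. x $ b) \<partial>ramp_strategy a c k) =
      (\<integral>\<^sup>+ s. ennreal (\<Sum>b\<in>UNIV. ramp a c k s $ b) \<partial>unit_uniform)"
    unfolding ramp_strategy_def by (subst nn_integral_distr) auto
  also have "\<dots> = (\<integral>\<^sup>+ s. ennreal (\<Sum>b\<in>UNIV. ramp a c k s $ b) * indicator {0..1} s \<partial>lborel)"
    using borel_measurable_ramp[of a c k]
    by (subst nn_integral_uniform_measure) (auto simp: divide_ennreal_def)
  also have "\<dots> = (\<integral>\<^sup>+ s. ennreal (\<Sum>b\<in>UNIV. ?g b s) \<partial>lborel)"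
    unfolding g[symmetric]
    by (intro nn_integral_cong) (simp add: indicator_def)
  also have "\<dots> = ennreal (\<Sum>b\<in>UNIV. a b * k b + c b * (k b)\<^sup>2 / 2)"
  proof (intro nn_integral_has_integral_lborel)
    show "(\<lambda>s. \<Sum>b\<in>UNIV. ?g b s) \<in> borel_measurable borel"
      by measurable
    show "((\<lambda>s. \<Sum>b\<in>UNIV. ?g b s) has_integral (\<Sum>b\<in>UNIV. a b * k b + c b * (k b)\<^sup>2 / 2)) UNIV"
      using int by (intro has_integral_sum) auto
  qed (rule sum_nonneg, rule nn)
  also have "\<dots> \<le> ennreal R"
    using budget by (rule ennreal_leI)
  finally have "(\<integral>\<^sup>+ x. ennreal (\<Sum>b\<in>UNIV. x $ b) \<partial>ramp_strategy a c k) \<le> ennreal R" .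
  moreover have "AE x in ramp_strategy a c k. \<forall>b. 0 \<le> x $ b"
    unfolding ramp_strategy_def
  proof (subst AE_distr_iff)
    show "AE s in unit_uniform. \<forall>b. 0 \<le> ramp a c k s $ b"
      by (rule AE_uniform_measureI) (auto simp: ramp_def a c)
  qed auto
  moreover have "prob_space (ramp_strategy a c k)"
    unfolding ramp_strategy_def by (rule prob_space_distr) simp
  moreover have "sets (ramp_strategy a c k) = sets borel"
    by (simp add: ramp_strategy_def)
  ultimately show ?thesis
    by (simp add: lotto_strategy_def)
qed

text \<open>A union bound on the driving variable \<open>s\<close>. In the applications
  \<open>{u<..1}\<close> holds the values at which the bid has dropped to 0 and
  \<open>{0..v}\<close> those at which the ramp bids too little; \<open>u = 1\<close> and
  \<open>v = 0\<close> give a null event.\<close>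

lemma measure_ramp_strategy_le:
  assumes sets: "{x. P (x $ b)} \<in> sets borel"
    and sub: "\<And>s. 0 \<le> s \<Longrightarrow> s \<le> 1 \<Longrightarrow> P (ramp a c k s $ b) \<Longrightarrow> s \<in> {u<..1} \<union> {0..v}"
    and u: "u \<le> 1" and v: "0 \<le> v"
  shows "measure (ramp_strategy a c k) {x. P (x $ b)} \<le> (1 - u) + v"
proof -
  let ?S = "{s. P (ramp a c k s $ b)}"
  have eq: "ramp a c k -` {x. P (x $ b)} = ?S" by auto
  have S: "?S \<in> sets borel"
    using measurable_sets[OF borel_measurable_ramp sets, of a c k] by (simp add: eq)
  have "measure (ramp_strategy a c k) {x. P (x $ b)} = measure unit_uniform ?S"
    unfolding ramp_strategy_def using sets by (subst measure_distr) (auto simp: eq)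
  also have "\<dots> = measure lborel ({0..1} \<inter> ?S)"
    using S by (subst measure_uniform_measure) auto
  also have "\<dots> \<le> measure lborel ({u<..1} \<union> {0..v})"
  proof (intro measure_mono_fmeasurable)
    show "{0..1} \<inter> ?S \<subseteq> {u<..1} \<union> {0..v}"
      by (intro subsetI sub) auto
    show "{u<..1} \<union> {0..v} \<in> fmeasurable lborel"
      using u v by (intro fmeasurable.Un) (auto simp: fmeasurable_def)
  qed (use S in auto)
  also have "\<dots> \<le> measure lborel {u<..1} + measure lborel {0..v}"
    by (rule measure_Un_le) auto
  also have "\<dots> = (1 - u) + v"
    using u v by simp
  finally show ?thesis .
qed

lemma lotto_strategy_0_AE:
  fixes F :: "(real^'n::finite) measure"
  assumes F: "lotto_strategy 0 F"
  shows "AE x in F. \<forall>b. x $ b = 0"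
proof -
  note D = lotto_strategyD[OF F]
  have [measurable_cong]: "sets F = sets borel" by fact
  have "(\<integral>\<^sup>+ x. ennreal (\<Sum>b\<in>UNIV. x $ b) \<partial>F) = 0"
    using F by (simp add: lotto_strategy_def)
  then have "AE x in F. ennreal (\<Sum>b\<in>UNIV. x $ b) = 0"
    by (subst (asm) nn_integral_0_iff_AE) auto
  with D(4) show ?thesis
  proof eventually_elim
    case (elim x)
    then have "(\<Sum>b\<in>UNIV. x $ b) = 0"
      using sum_nonneg[of UNIV "\<lambda>b. x $ b"] by (auto simp: ennreal_eq_0_iff)
    with elim show ?case by (subst (asm) sum_nonneg_eq_0_iff) auto
  qed
qed

lemma vec_halfspace_borel:
  fixes b :: "'n::finite"
  shows "{y. x + p > q * y $ b} \<in> sets (borel :: (real^'n) measure)"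
    and "{x. x $ b + p \<le> q * y} \<in> sets (borel :: (real^'n) measure)"
  by measurable

subsection \<open>Guarantees of the two players\<close>

text \<open>The slope \<open>w $ b / (u * q)\<close> lets an extra resource of A raise its chance on
  \<open>b\<close> at rate at most \<open>u / w $ b\<close>, so it is worth at most \<open>u\<close>
  on every battlefield: \<open>u\<close> is A's shadow price.\<close>

definition strategyB :: "real \<Rightarrow> real^'n \<Rightarrow> real^'n \<Rightarrow> real \<Rightarrow> ('n \<Rightarrow> real) \<Rightarrow> (real^'n::finite) measure" where
  "strategyB q w p u \<theta> = ramp_strategy (\<lambda>b. p $ b / q) (\<lambda>b. w $ b / (u * q)) \<theta>"

text \<open>For \<open>u = 0\<close> the convention \<open>x / 0 = 0\<close> turns the ramp into an atom at \<open>p $ b / q\<close>,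
which is what B should play against an opponent without real-time resources.\<close>

lemma strategyB_guarantee:
  fixes w p :: "real^'n::finite" and \<theta> :: "'n \<Rightarrow> real"
  assumes w: "\<forall>b. 0 < w $ b" and q: "0 < q" and p: "\<And>b. 0 \<le> p $ b" and RA: "0 \<le> RA"
    and \<theta>: "\<And>b. 0 \<le> \<theta> b" "\<And>b. \<theta> b \<le> 1" and u: "0 \<le> u" "u = 0 \<longrightarrow> RA = 0"
    and budget: "(\<Sum>b\<in>UNIV. p $ b * \<theta> b + w $ b * (\<theta> b)\<^sup>2 / (2 * u)) \<le> q * RB"
  shows "lotto_strategy RB (strategyB q w p u \<theta>)"
    and "lotto_strategy RA FA \<Longrightarrow>
      payoffA q w p FA (strategyB q w p u \<theta>) \<le> (\<Sum>b\<in>UNIV. w $ b * (1 - \<theta> b)) + RA * u"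
proof -
  show B: "lotto_strategy RB (strategyB q w p u \<theta>)"
    unfolding strategyB_def
  proof (rule lotto_strategy_ramp)
    have "(\<Sum>b\<in>UNIV. p $ b / q * \<theta> b + w $ b / (u * q) * (\<theta> b)\<^sup>2 / 2) =
        (\<Sum>b\<in>UNIV. p $ b * \<theta> b + w $ b * (\<theta> b)\<^sup>2 / (2 * u)) / q"
      using q by (simp add: sum_divide_distrib add_divide_distrib mult_ac)
    then show "(\<Sum>b\<in>UNIV. p $ b / q * \<theta> b + w $ b / (u * q) * (\<theta> b)\<^sup>2 / 2) \<le> RB"
      using budget q by (simp add: divide_le_eq mult_ac)
  qed (use \<theta> p q u w in \<open>auto simp: less_imp_le\<close>)
  assume A: "lotto_strategy RA FA"
  interpret A: prob_space FA using lotto_strategyD(1)[OF A] .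
  note mean = lotto_strategy_mean[OF A RA]
  have bound: "AE x in FA. measure (strategyB q w p u \<theta>) {y. x $ b + p $ b > q * y $ b}
      \<le> (1 - \<theta> b) + x $ b * (u / w $ b)" for b
  proof -
    \<comment> \<open>For \<open>u = 0\<close> the summand in \<open>x $ b\<close> is 0, so A must
      not outbid the atom at \<open>p $ b / q\<close>. Indeed \<open>RA = 0\<close> then, and A bids
      0 almost surely.\<close>
    have "AE x in FA. u = 0 \<longrightarrow> (\<forall>b. x $ b = 0)"
      using u(2) lotto_strategy_0_AE A by (cases "u = 0") auto
    with lotto_strategyD(4)[OF A] show ?thesis
    proof eventually_elim
      case (elim x)
      have "s \<in> {\<theta> b<..1} \<union> {0..x $ b * (u / w $ b)}"
        if s: "0 \<le> s" "s \<le> 1"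
          and win: "x $ b + p $ b > q * ramp (\<lambda>b. p $ b / q) (\<lambda>b. w $ b / (u * q)) \<theta> s $ b" for s
      proof (cases "s \<le> \<theta> b")
        case True
        then have "x $ b > w $ b / u * s"
          using win q by (simp add: ramp_def distrib_left)
        moreover from this have "u > 0"
          using u elim by (cases "u = 0") auto
        ultimately have "s \<le> x $ b * (u / w $ b)"
          using w by (simp add: field_simps)
        with s show ?thesis by simp
      qed (use s in auto)
      then show ?case
        unfolding strategyB_def
        using elim u w \<theta> by (intro measure_ramp_strategy_le) (auto simp: less_imp_le vec_halfspace_borel)
    qed
  qed
  have "payoffA q w p FA (strategyB q w p u \<theta>)
      \<le> (\<Sum>b\<in>UNIV. w $ b * (\<integral>x. (1 - \<theta> b) + x $ b * (u / w $ b) \<partial>FA))"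
    using w A B mean(1) bound by (intro payoffA_le) auto
  also have "\<dots> = (\<Sum>b\<in>UNIV. w $ b * (1 - \<theta> b) + (\<integral>x. x $ b \<partial>FA) * u)"
  proof (intro sum.cong refl)
    fix b
    have "w $ b \<noteq> 0" using w by (metis less_irrefl)
    then show "w $ b * (\<integral>x. (1 - \<theta> b) + x $ b * (u / w $ b) \<partial>FA) =
        w $ b * (1 - \<theta> b) + (\<integral>x. x $ b \<partial>FA) * u"
      using mean(1)[of b] by (simp add: distrib_left A.prob_space)
  qed
  also have "\<dots> = (\<Sum>b\<in>UNIV. w $ b * (1 - \<theta> b)) + (\<Sum>b\<in>UNIV. \<integral>x. x $ b \<partial>FA) * u"
    by (simp add: sum.distrib sum_distrib_right)
  also have "\<dots> \<le> (\<Sum>b\<in>UNIV. w $ b * (1 - \<theta> b)) + RA * u"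
    using mean(2) u(1) by (simp add: mult_right_mono)
  finally show "payoffA q w p FA (strategyB q w p u \<theta>)
    \<le> (\<Sum>b\<in>UNIV. w $ b * (1 - \<theta> b)) + RA * u" .
qed

text \<open>With probability \<open>\<theta> b / t\<close> the bid is uniform between 0 and
  \<open>w $ b * \<theta> b / u\<close>, which is how far B's bids in \<open>strategyB\<close>,
  scaled by \<open>q\<close>, reach above \<open>p $ b\<close>. Beyond that threshold B's marginal
  gain per resource is at most \<open>q * u / t\<close> on every battlefield.\<close>

definition strategyA :: "real^'n \<Rightarrow> real \<Rightarrow> real \<Rightarrow> ('n \<Rightarrow> real) \<Rightarrow> (real^'n::finite) measure" where
  "strategyA w t u \<theta> = ramp_strategy (\<lambda>b. 0) (\<lambda>b. w $ b * t / u) (\<lambda>b. \<theta> b / t)"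

text \<open>Once \<open>q * y $ b\<close> reaches \<open>p $ b\<close>, A's losing probability is
  bounded by an affine function of \<open>y $ b\<close>, whose intercept \<open>c b\<close>
  dominates. Below \<open>p $ b\<close> A always wins, and \<open>0 \<le> c b\<close> keeps the
  affine bound valid there too.\<close>

lemma strategyA_guarantee:
  fixes w p :: "real^'n::finite" and \<theta> c :: "'n \<Rightarrow> real"
  assumes w: "\<forall>b. 0 < w $ b" and q: "0 < q" and p: "\<And>b. 0 \<le> p $ b" and RB: "0 \<le> RB"
    and t: "0 < t" and u: "0 < u" and \<theta>: "\<And>b. 0 \<le> \<theta> b" "\<And>b. \<theta> b \<le> t"
    and c: "\<And>b. 0 \<le> c b" "\<And>b. t - \<theta> b - p $ b * u / w $ b \<le> t * c b"
    and budget: "(\<Sum>b\<in>UNIV. w $ b * (\<theta> b)\<^sup>2) \<le> 2 * t * RA * u"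
  shows "lotto_strategy RA (strategyA w t u \<theta>)"
    and "lotto_strategy RB FB \<Longrightarrow>
      (\<Sum>b\<in>UNIV. w $ b * (1 - c b)) - q * RB * u / t \<le> payoffA q w p (strategyA w t u \<theta>) FB"
proof -
  show A: "lotto_strategy RA (strategyA w t u \<theta>)"
    unfolding strategyA_def
  proof (rule lotto_strategy_ramp)
    have "(\<Sum>b\<in>UNIV. 0 * (\<theta> b / t) + w $ b * t / u * (\<theta> b / t)\<^sup>2 / 2) =
        (\<Sum>b\<in>UNIV. w $ b * (\<theta> b)\<^sup>2) / (2 * t * u)"
      unfolding sum_divide_distrib using t u
      by (intro sum.cong) (auto simp: field_simps power2_eq_square)
    then show "(\<Sum>b\<in>UNIV. 0 * (\<theta> b / t) + w $ b * t / u * (\<theta> b / t)\<^sup>2 / 2) \<le> RA"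
      using budget t u by (simp add: divide_le_eq mult_ac)
  qed (use \<theta> t u w in \<open>auto simp: less_imp_le\<close>)
  assume B: "lotto_strategy RB FB"
  interpret B: prob_space FB using lotto_strategyD(1)[OF B] .
  note mean = lotto_strategy_mean[OF B RB]
  have bound: "AE y in FB. measure (strategyA w t u \<theta>) {x. x $ b + p $ b \<le> q * y $ b}
      \<le> c b + y $ b * (q * u / (w $ b * t))" for b
    using lotto_strategyD(4)[OF B]
  proof eventually_elim
    case (elim y)
    have wb: "0 < w $ b" using w by simp
    let ?r = "ramp (\<lambda>b. 0) (\<lambda>b. w $ b * t / u) (\<lambda>b. \<theta> b / t)"
    have r: "?r s $ b = (if s \<le> \<theta> b / t then w $ b * t / u * s else 0)" for s
      by (simp add: ramp_def)
    show ?case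
    proof (cases "q * y $ b < p $ b")
      case True
      have "measure (strategyA w t u \<theta>) {x. x $ b + p $ b \<le> q * y $ b} \<le> (1 - 1) + 0"
        unfolding strategyA_def
      proof (rule measure_ramp_strategy_le)
        fix s :: real
        assume s: "0 \<le> s" "?r s $ b + p $ b \<le> q * y $ b"
        have "0 \<le> ?r s $ b"
          using s(1) wb t u by (simp add: r)
        with s(2) True show "s \<in> {1<..1} \<union> {0..0}" by simp
      qed (auto simp: vec_halfspace_borel)
      also have "\<dots> \<le> c b + y $ b * (q * u / (w $ b * t))"
        using c(1)[of b] elim q u t wb by simp
      finally show ?thesis .
    next
      case False
      have "measure (strategyA w t u \<theta>) {x. x $ b + p $ b \<le> q * y $ b}
          \<le> (1 - \<theta> b / t) + (q * y $ b - p $ b) * (u / (w $ b * t))"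
        unfolding strategyA_def
      proof (rule measure_ramp_strategy_le)
        fix s :: real
        assume s: "0 \<le> s" "s \<le> 1" "?r s $ b + p $ b \<le> q * y $ b"
        show "s \<in> {\<theta> b / t<..1} \<union> {0..(q * y $ b - p $ b) * (u / (w $ b * t))}"
        proof (cases "s \<le> \<theta> b / t")
          case True
          then have "w $ b * t / u * s + p $ b \<le> q * y $ b"
            using s(3) by (simp only: r if_True)
          then have "s \<le> (q * y $ b - p $ b) * (u / (w $ b * t))"
            using wb t u by (simp add: field_simps)
          with s(1) show ?thesis by simp
        qed (use s in auto)
      qed (use False \<theta> t u wb in \<open>auto simp: vec_halfspace_borel\<close>)
      also have "\<dots> = (t - \<theta> b - p $ b * u / w $ b) / t + y $ b * (q * u / (w $ b * t))"
        using t wb by (simp add: field_simps)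
      also have "\<dots> \<le> c b + y $ b * (q * u / (w $ b * t))"
        using c(2)[of b] t by (simp add: divide_le_eq mult.commute)
      finally show ?thesis .
    qed
  qed
  have "(\<Sum>b\<in>UNIV. w $ b * (1 - c b)) - q * RB * u / t
      \<le> (\<Sum>b\<in>UNIV. w $ b * (1 - c b)) - (\<Sum>b\<in>UNIV. \<integral>y. y $ b \<partial>FB) * (q * u / t)"
    using mult_right_mono[OF mean(2), of "q * u / t"] q u t by (simp add: mult_ac)
  also have "\<dots> = (\<Sum>b\<in>UNIV. w $ b * (1 - c b) - (\<integral>y. y $ b \<partial>FB) * (q * u / t))"
    by (simp only: sum_subtractf sum_distrib_right)
  also have "\<dots> = (\<Sum>b\<in>UNIV. w $ b * (1 - (\<integral>y. c b + y $ b * (q * u / (w $ b * t)) \<partial>FB)))"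
  proof (intro sum.cong refl)
    fix b
    have "w $ b \<noteq> 0" using w by (metis less_irrefl)
    then show "w $ b * (1 - c b) - (\<integral>y. y $ b \<partial>FB) * (q * u / t) =
        w $ b * (1 - (\<integral>y. c b + y $ b * (q * u / (w $ b * t)) \<partial>FB))"
      using mean(1)[of b] by (simp add: right_diff_distrib distrib_left B.prob_space)
  qed
  also have "\<dots> \<le> payoffA q w p (strategyA w t u \<theta>) FB"
    using w A B mean(1) bound by (intro payoffA_ge) auto
  finally show "(\<Sum>b\<in>UNIV. w $ b * (1 - c b)) - q * RB * u / t
    \<le> payoffA q w p (strategyA w t u \<theta>) FB" .
qed

section \<open>Saddle points and the equilibrium payoff\<close>

text \<open>Pitting each half of the saddle point against the strategies of another equilibrium
  squeezes that equilibrium's payoff to \<open>v\<close>. This uniqueness makes the definite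
  description in \<open>piA\<close> denote \<open>v\<close>.\<close>

lemma saddle_point:
  assumes A: "lotto_strategy RA FA" and B: "lotto_strategy RB FB"
    and le: "\<And>FA'. lotto_strategy RA FA' \<Longrightarrow> payoffA q w p FA' FB \<le> v"
    and ge: "\<And>FB'. lotto_strategy RB FB' \<Longrightarrow> v \<le> payoffA q w p FA FB'"
  shows "lotto_NE q w p RA RB FA FB" and "piA q w p RA RB = v"
proof -
  have v: "payoffA q w p FA FB = v"
    using le[OF A] ge[OF B] by simp
  then show NE: "lotto_NE q w p RA RB FA FB"
    using A B le ge by (simp add: lotto_NE_def)
  have "payoffA q w p FA' FB' = v" if NE': "lotto_NE q w p RA RB FA' FB'" for FA' FB'
  proof (rule antisym)
    have A': "lotto_strategy RA FA'" and B': "lotto_strategy RB FB'"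
      using NE' by (auto simp: lotto_NE_def)
    have "payoffA q w p FA' FB' \<le> payoffA q w p FA' FB"
      using NE' B by (simp add: lotto_NE_def)
    with le[OF A'] show "payoffA q w p FA' FB' \<le> v" by simp
    have "payoffA q w p FA FB' \<le> payoffA q w p FA' FB'"
      using NE' A by (simp add: lotto_NE_def)
    with ge[OF B'] show "v \<le> payoffA q w p FA' FB'" by simp
  qed
  with NE v show "piA q w p RA RB = v"
    unfolding piA_def by (intro the_equality) auto
qed

text \<open>What any single strategy of B concedes bounds A's equilibrium payoff. The equilibrium is
  assumed because it gives the description in \<open>piA\<close> its meaning.\<close>

lemma piA_le_payoffA_bound:
  assumes "lotto_NE q w p RA RB FA FB" and B: "lotto_strategy RB FB'"
    and le: "\<And>FA'. lotto_strategy RA FA' \<Longrightarrow> payoffA q w p FA' FB' \<le> v"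
  shows "piA q w p RA RB \<le> v"
proof -
  have NE: "lotto_strategy RA FA" "lotto_strategy RB FB"
    "\<And>FA'. lotto_strategy RA FA' \<Longrightarrow> payoffA q w p FA' FB \<le> payoffA q w p FA FB"
    "\<And>FB'. lotto_strategy RB FB' \<Longrightarrow> payoffA q w p FA FB \<le> payoffA q w p FA FB'"
    using assms(1) by (auto simp: lotto_NE_def)
  have "piA q w p RA RB = payoffA q w p FA FB"
    using NE by (intro saddle_point(2)[of RA FA RB FB]) auto
  also have "\<dots> \<le> payoffA q w p FA FB'"
    using NE B by simp
  also have "\<dots> \<le> v"
    using le NE by simp
  finally show ?thesis .
qed

subsection \<open>Equilibria for a fixed pre-allocation\<close>

text \<open>The first-order condition of B's problem: minimise
  \<open>(\<Sum>b\<in>UNIV. w $ b * (1 - \<theta> b)) + RA * u\<close> at cost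
  \<open>(\<Sum>b\<in>UNIV. p $ b * \<theta> b + w $ b * (\<theta> b)\<^sup>2 / (2 * u)) = q *
  RB\<close>. With multiplier \<open>u / t\<close> and \<open>r = p $ b / w $ b\<close> it reads
  \<open>\<theta> b = t - r * u\<close>, here truncated to the unit interval.\<close>

definition capped :: "real \<Rightarrow> real \<Rightarrow> real \<Rightarrow> real" where
  "capped r t u = min 1 (max 0 (t - r * u))"

lemma capped_bounds: "0 \<le> capped r t u" "capped r t u \<le> 1"
  by (auto simp: capped_def)

lemma capped_le:
  assumes "0 \<le> r" "0 \<le> u" "0 \<le> t"
  shows "capped r t u \<le> t"
proof -
  have "0 \<le> r * u" using assms by simp
  then show ?thesis unfolding capped_def using assms by linarith
qed

lemma capped_antimono: "0 \<le> r \<Longrightarrow> u \<le> v \<Longrightarrow> capped r t v \<le> capped r t u"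
  using mult_left_mono[of u v r] by (auto simp: capped_def)

text \<open>The factor \<open>t - r * u - capped r t u\<close> is at most 0 where the value is 0,
  vanishes in between and is nonnegative where the value is 1. Hence the product, divided by
  \<open>t\<close>, can serve as \<open>c\<close> in \<open>strategyA_guarantee\<close>.\<close>

lemma capped_complementary:
  "t - capped r t u - r * u \<le> capped r t u * (t - r * u - capped r t u)"
  "0 \<le> capped r t u * (t - r * u - capped r t u)"
  by (auto simp: capped_def min_def max_def)

text \<open>The first equation determines \<open>u\<close> continuously from \<open>t\<close>, because its right side minus
its left side is strictly increasing in \<open>u\<close>; the second is then solved for \<open>t\<close>.\<close>

lemma equilibrium_system:
  fixes w p :: "'n::finite \<Rightarrow> real" and RA Q :: real
  assumes w: "\<And>b. 0 < w b" and p: "\<And>b. 0 \<le> p b" and RA: "0 < RA" and Q: "0 < Q"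
  obtains t u where "0 < t" "0 < u"
    "(\<Sum>b\<in>UNIV. w b * (capped (p b / w b) t u)\<^sup>2) = 2 * t * RA * u"
    "t * RA + (\<Sum>b\<in>UNIV. p b * capped (p b / w b) t u) = Q"
proof -
  define r where "r b = p b / w b" for b
  have r: "0 \<le> r b" for b using w[of b] p[of b] by (simp add: r_def)
  define f where "f t u = 2 * t * RA * u - (\<Sum>b\<in>UNIV. w b * (capped (r b) t u)\<^sup>2)" for t u
  have "\<exists>u>0. f t u = 0" if t: "0 < t" for t
  proof -
    define u1 where "u1 = (\<Sum>b\<in>UNIV. w b) / (2 * t * RA)"
    have f0: "f t 0 < 0"
      using t w by (auto simp: f_def capped_def intro!: sum_pos)
    have "(\<Sum>b\<in>UNIV. w b * (capped (r b) t u1)\<^sup>2) \<le> (\<Sum>b\<in>UNIV. w b * 1)"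
      using w capped_bounds
      by (intro sum_mono mult_left_mono) (auto simp: power_le_one less_imp_le)
    then have f1: "0 \<le> f t u1"
      using t RA by (simp add: f_def u1_def)
    have "0 \<le> u1"
      using t RA w by (auto simp: u1_def less_imp_le intro!: divide_nonneg_nonneg sum_nonneg)
    moreover have "continuous_on {0..u1} (f t)"
      unfolding f_def capped_def by (intro continuous_intros)
    ultimately obtain u where "0 \<le> u" "f t u = 0"
      using f0 f1 IVT'[of "f t" 0 0 u1] by auto
    with f0 have "0 < u" by (cases "u = 0") auto
    with \<open>f t u = 0\<close> show ?thesis by auto
  qed
  then obtain U where U: "\<And>t. 0 < t \<Longrightarrow> 0 < U t" "\<And>t. 0 < t \<Longrightarrow> f t (U t) = 0"
    by metis
  \<comment> \<open>The subtracted sum is antitone in \<open>u\<close>, so \<open>f t\<close> grows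
    at least at rate \<open>2 * t * RA\<close>. Values of \<open>f s\<close> therefore control the
    distance to the root \<open>U s\<close>, which yields the continuity of
    \<open>U\<close>.\<close>
  have mono: "2 * t * RA * (v - u) \<le> f t v - f t u" if "u \<le> v" for t u v
  proof -
    have "(\<Sum>b\<in>UNIV. w b * (capped (r b) t v)\<^sup>2) \<le> (\<Sum>b\<in>UNIV. w b * (capped (r b) t u)\<^sup>2)"
      using w r that capped_bounds
      by (intro sum_mono mult_left_mono power_mono capped_antimono) (auto simp: less_imp_le)
    then show ?thesis by (simp add: f_def algebra_simps)
  qed
  have dist: "2 * t * RA * \<bar>u - v\<bar> \<le> \<bar>f t u - f t v\<bar>" for t u v
    using mono[of u v t] mono[of v u t] by (cases "u \<le> v") (auto simp: abs_if)
  have U_cont: "isCont U t" if t: "0 < t" for t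
  proof -
    have "((\<lambda>s. \<bar>f s (U t)\<bar> / (2 * s * RA)) \<longlongrightarrow> \<bar>f t (U t)\<bar> / (2 * t * RA)) (at t)"
      unfolding f_def capped_def using t RA by (intro tendsto_intros) auto
    then have lim: "((\<lambda>s. \<bar>f s (U t)\<bar> / (2 * s * RA)) \<longlongrightarrow> 0) (at t)"
      using U(2)[OF t] by simp
    have "\<forall>\<^sub>F s in at t. 0 < s"
      using t by (intro order_tendstoD(1)[OF tendsto_ident_at])
    then have "\<forall>\<^sub>F s in at t. norm (U s - U t) \<le> \<bar>f s (U t)\<bar> / (2 * s * RA)"
    proof eventually_elim
      case (elim s)
      then show ?case
        using dist[of s "U s" "U t"] U(2)[of s] RA by (simp add: field_simps)
    qed
    then have "((\<lambda>s. U s - U t) \<longlongrightarrow> 0) (at t)"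
      using lim by (rule Lim_null_comparison)
    then show ?thesis
      unfolding isCont_def by (rule LIM_zero_cancel)
  qed
  define g where "g t = t * RA + (\<Sum>b\<in>UNIV. p b * capped (r b) t (U t))" for t
  \<comment> \<open>Endpoints for the intermediate value theorem: \<open>capped\<close> is at most
    \<open>t\<close>, so \<open>g t \<le> t * (RA + (\<Sum>b\<in>UNIV. p b))\<close>, and it is
    nonnegative, so \<open>t * RA \<le> g t\<close>.\<close>
  define t0 where "t0 = Q / (RA + (\<Sum>b\<in>UNIV. p b))"
  define t1 where "t1 = Q / RA"
  have sp: "0 \<le> (\<Sum>b\<in>UNIV. p b)" using p by (simp add: sum_nonneg)
  have t0: "0 < t0" and t01: "t0 \<le> t1"
    using Q RA sp by (auto simp: t0_def t1_def intro!: divide_left_mono divide_pos_pos)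
  have "(\<Sum>b\<in>UNIV. p b * capped (r b) t0 (U t0)) \<le> (\<Sum>b\<in>UNIV. p b * t0)"
    using p r t0 U(1)[OF t0]
    by (intro sum_mono mult_left_mono capped_le) (auto simp: less_imp_le)
  then have "g t0 \<le> t0 * (RA + (\<Sum>b\<in>UNIV. p b))"
    by (simp add: g_def distrib_left sum_distrib_left mult.commute)
  then have "g t0 \<le> Q"
    using RA sp by (simp add: t0_def)
  moreover have "Q \<le> g t1"
    using RA p capped_bounds by (auto simp: g_def t1_def intro!: sum_nonneg)
  moreover have "isCont g t" if "0 < t" for t
    unfolding g_def capped_def using U_cont[OF that] by (intro continuous_intros)
  then have "continuous_on {t0..t1} g"
    using t0 by (intro continuous_at_imp_continuous_on) auto
  ultimately obtain t where t: "t0 \<le> t" "g t = Q"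
    using t01 IVT'[of g t0 Q t1] by auto
  with t0 have "0 < t" by simp
  with t(2) U[of t] show ?thesis
    by (intro that[of t "U t"]) (auto simp: f_def g_def r_def)
qed

text \<open>For \<open>\<theta>\<close> given by \<open>capped\<close> the guarantees of the two
  players coincide and form a saddle point. The equations for \<open>t\<close> and \<open>u\<close>
  are exported because the closed form of the value is computed from them.\<close>

lemma lotto_equilibrium_pos:
  fixes w p :: "real^'n::finite"
  assumes w: "\<forall>b. 0 < w $ b" and q: "0 < q" and p: "\<And>b. 0 \<le> p $ b" and RA: "0 < RA" and RB: "0 < RB"
  obtains FA FB t u where "0 < t" "0 < u" "lotto_NE q w p RA RB FA FB"
    "(\<Sum>b\<in>UNIV. w $ b * (capped (p $ b / w $ b) t u)\<^sup>2) = 2 * t * RA * u"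
    "t * RA + (\<Sum>b\<in>UNIV. p $ b * capped (p $ b / w $ b) t u) = q * RB"
    "piA q w p RA RB = (\<Sum>b\<in>UNIV. w $ b * (1 - capped (p $ b / w $ b) t u)) + RA * u"
proof -
  obtain t u where t: "0 < t" and u: "0 < u"
    and eq1: "(\<Sum>b\<in>UNIV. w $ b * (capped (p $ b / w $ b) t u)\<^sup>2) = 2 * t * RA * u"
    and eq2: "t * RA + (\<Sum>b\<in>UNIV. p $ b * capped (p $ b / w $ b) t u) = q * RB"
    by (rule equilibrium_system[of "\<lambda>b. w $ b" "\<lambda>b. p $ b" RA "q * RB"]) (use w p RA q RB in auto)
  define \<theta> where "\<theta> b = capped (p $ b / w $ b) t u" for b
  \<comment> \<open>Complementary slackness: \<open>c b\<close> can be nonzero only where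
    \<open>\<theta> b = 1\<close>.\<close>
  define c where "c b = \<theta> b * (t - p $ b / w $ b * u - \<theta> b) / t" for b
  define v where "v = (\<Sum>b\<in>UNIV. w $ b * (1 - \<theta> b)) + RA * u"
  have wn: "w $ b \<noteq> 0" for b using w by (metis less_irrefl)
  have \<theta>: "0 \<le> \<theta> b" "\<theta> b \<le> 1" "\<theta> b \<le> t" for b
    using capped_bounds capped_le w p t u by (auto simp: \<theta>_def less_imp_le)
  \<comment> \<open>By \<open>eq1\<close> B's bids above the pre-allocations cost
    \<open>t * RA\<close>, so \<open>eq2\<close> says that B spends its budget exactly.\<close>
  have "(\<Sum>b\<in>UNIV. w $ b * (\<theta> b)\<^sup>2 / (2 * u)) = t * RA"
    using eq1 u by (simp add: \<theta>_def flip: sum_divide_distrib)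
  then have budgetB: "(\<Sum>b\<in>UNIV. p $ b * \<theta> b + w $ b * (\<theta> b)\<^sup>2 / (2 * u)) \<le> q * RB"
    using eq2 by (simp add: sum.distrib \<theta>_def)
  have c: "0 \<le> c b" "t - \<theta> b - p $ b * u / w $ b \<le> t * c b" for b
    using capped_complementary(1)[of t "p $ b / w $ b" u] capped_complementary(2)[of "p $ b / w $ b" t u] t by (auto simp: c_def \<theta>_def)
  \<comment> \<open>After multiplication by \<open>t\<close>, \<open>eq2\<close> replaces the sum of
    \<open>p $ b * \<theta> b\<close> and \<open>eq1\<close> the sum of the weighted
    squares.\<close>
  have A_value: "(\<Sum>b\<in>UNIV. w $ b * (1 - c b)) - q * RB * u / t = v"
  proof -
    have "t * (w $ b * c b) = t * (w $ b * \<theta> b) - u * (p $ b * \<theta> b) - w $ b * (\<theta> b)\<^sup>2" for b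
      using t wn[of b] by (simp add: c_def field_simps power2_eq_square)
    then have "t * (\<Sum>b\<in>UNIV. w $ b * c b) =
        t * (\<Sum>b\<in>UNIV. w $ b * \<theta> b) - u * (\<Sum>b\<in>UNIV. p $ b * \<theta> b) - (\<Sum>b\<in>UNIV. w $ b * (\<theta> b)\<^sup>2)"
      by (simp add: sum_distrib_left sum_subtractf)
    also have "\<dots> = t * (\<Sum>b\<in>UNIV. w $ b * \<theta> b) - u * (q * RB - t * RA) - 2 * t * RA * u"
    proof -
      have "(\<Sum>b\<in>UNIV. p $ b * \<theta> b) = q * RB - t * RA"
        using eq2 by (simp add: \<theta>_def)
      then show ?thesis using eq1 by (simp add: \<theta>_def)
    qed
    finally have "(\<Sum>b\<in>UNIV. w $ b * c b) = (\<Sum>b\<in>UNIV. w $ b * \<theta> b) - RA * u - q * RB * u / t"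
      using t by (simp add: field_simps)
    then show ?thesis
      by (simp add: v_def right_diff_distrib sum_subtractf)
  qed
  note A = strategyA_guarantee[where w = w and q = q and p = p and RA = RA and RB = RB and \<theta> = \<theta> and c = c]
  note B = strategyB_guarantee[where w = w and q = q and p = p and RA = RA and RB = RB and \<theta> = \<theta>]
  have sA: "lotto_strategy RA (strategyA w t u \<theta>)"
    using w q p RB t u \<theta> c eq1 by (intro A(1)) (auto simp: \<theta>_def)
  have sB: "lotto_strategy RB (strategyB q w p u \<theta>)"
    using w q p RA u \<theta> budgetB by (intro B(1)) auto
  have le: "payoffA q w p FA' (strategyB q w p u \<theta>) \<le> v" if "lotto_strategy RA FA'" for FA'
    unfolding v_def using w q p RA u \<theta> budgetB that by (intro B(2)) auto
  have ge: "v \<le> payoffA q w p (strategyA w t u \<theta>) FB'" if "lotto_strategy RB FB'" for FB'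
    unfolding A_value[symmetric]
    using w q p RB t u \<theta> c eq1 that by (intro A(2)) (auto simp: \<theta>_def)
  note saddle_point[OF sA sB le ge]
  then show ?thesis
    using t u eq1 eq2 by (intro that) (auto simp: v_def \<theta>_def)
qed

text \<open>Without real-time resources for A, B solves a fractional knapsack problem in the
probabilities \<open>\<theta>\<close> of matching the pre-allocations.\<close>

lemma lotto_equilibrium_zero:
  fixes w p :: "real^'n::finite"
  assumes w: "\<forall>b. 0 < w $ b" and q: "0 < q" and p: "\<And>b. 0 \<le> p $ b" and RB: "0 < RB"
  obtains FA FB and \<theta> :: "'n \<Rightarrow> real" where "lotto_NE q w p 0 RB FA FB"
    "\<forall>b. 0 \<le> \<theta> b \<and> \<theta> b \<le> 1" "(\<Sum>b\<in>UNIV. p $ b * \<theta> b) \<le> q * RB"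
    "piA q w p 0 RB = (\<Sum>b\<in>UNIV. w $ b * (1 - \<theta> b))"
proof -
  define K where "K = cbox 0 1 \<inter> {\<theta>::real^'n. (\<Sum>b\<in>UNIV. p $ b * \<theta> $ b) \<le> q * RB}"
  have K: "\<theta> \<in> K \<longleftrightarrow> (\<forall>b. 0 \<le> \<theta> $ b \<and> \<theta> $ b \<le> 1) \<and> (\<Sum>b\<in>UNIV. p $ b * \<theta> $ b) \<le> q * RB" for \<theta>
    by (simp add: K_def mem_box_cart)
  have "compact K"
    unfolding K_def by (intro compact_Int_closed compact_cbox closed_Collect_le continuous_intros)
  moreover have "0 \<in> K"
    using q RB by (simp add: K)
  moreover have "continuous_on K (\<lambda>\<theta>. \<Sum>b\<in>UNIV. w $ b * (1 - \<theta> $ b))"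
    by (intro continuous_intros)
  ultimately obtain \<theta> where \<theta>: "\<theta> \<in> K"
    and opt: "\<And>\<theta>'. \<theta>' \<in> K \<Longrightarrow> (\<Sum>b\<in>UNIV. w $ b * (1 - \<theta> $ b)) \<le> (\<Sum>b\<in>UNIV. w $ b * (1 - \<theta>' $ b))"
    using continuous_attains_inf[of K] by blast
  define v where "v = (\<Sum>b\<in>UNIV. w $ b * (1 - \<theta> $ b))"
  let ?z = "\<lambda>b::'n. 0::real"
  let ?A = "ramp_strategy ?z ?z ?z"
  let ?B = "strategyB q w p 0 (\<lambda>b. \<theta> $ b)"
  have sA: "lotto_strategy 0 ?A"
    by (rule lotto_strategy_ramp) auto
  have sB: "lotto_strategy RB ?B"
    using w q p \<theta> by (intro strategyB_guarantee(1)[where RA = 0]) (auto simp: K)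
  have le: "payoffA q w p FA' ?B \<le> v" if "lotto_strategy 0 FA'" for FA'
    using strategyB_guarantee(2)[of w q p 0 "\<lambda>b. \<theta> $ b" 0 RB FA'] w q p \<theta> that
    by (auto simp: K v_def)
  have ge: "v \<le> payoffA q w p ?A FB'" if B: "lotto_strategy RB FB'" for FB'
  proof -
    note DB = lotto_strategyD[OF B]
    interpret B: prob_space FB' by (rule DB)
    note mean = lotto_strategy_mean[OF B less_imp_le[OF RB]]
    have [measurable_cong]: "sets FB' = sets borel" by (rule DB)
    define M where "M b = {y::real^'n. p $ b \<le> q * y $ b}" for b
    have M: "M b \<in> sets FB'" for b
      unfolding DB(2) M_def by measurable
    \<comment> \<open>The probabilities with which \<open>FB'\<close> reaches the pre-allocations.
      By a Markov-type estimate they fit B's budget, so they are feasible in the knapsack and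
      concede at least its optimum \<open>v\<close>.\<close>
    define \<theta>' :: "real^'n" where "\<theta>' = (\<chi> b. measure FB' (M b))"
    have "p $ b * \<theta>' $ b \<le> q * (\<integral>y. y $ b \<partial>FB')" for b
    proof -
      have "(\<integral>y. p $ b * indicator (M b) y \<partial>FB') \<le> (\<integral>y. q * y $ b \<partial>FB')"
      proof (rule integral_mono_AE)
        show "AE y in FB'. p $ b * indicator (M b) y \<le> q * y $ b"
          using DB(4) by eventually_elim (use q in \<open>auto simp: M_def indicator_def\<close>)
      qed (use M mean(1) in \<open>auto simp: B.emeasure_eq_measure\<close>)
      then show ?thesis
        using M by (simp add: \<theta>'_def)
    qed
    then have "(\<Sum>b\<in>UNIV. p $ b * \<theta>' $ b) \<le> q * (\<Sum>b\<in>UNIV. \<integral>y. y $ b \<partial>FB')"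
      by (simp add: sum_distrib_left sum_mono)
    also have "\<dots> \<le> q * RB"
      using mean(2) q by simp
    finally have "\<theta>' \<in> K"
      by (simp add: K \<theta>'_def)
    then have "v \<le> (\<Sum>b\<in>UNIV. w $ b * (1 - \<theta>' $ b))"
      unfolding v_def by (rule opt)
    also have "\<dots> = (\<Sum>b\<in>UNIV. w $ b * (1 - (\<integral>y. indicator (M b) y \<partial>FB')))"
      using M by (simp add: \<theta>'_def)
    also have "\<dots> \<le> payoffA q w p ?A FB'"
    proof (rule payoffA_ge[OF w sA B])
      fix b
      show "integrable FB' (indicator (M b) :: _ \<Rightarrow> real)"
        using M by (simp add: B.emeasure_eq_measure)
      show "AE y in FB'. measure ?A {x. x $ b + p $ b \<le> q * y $ b} \<le> indicator (M b) y"
      proof (rule AE_I2)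
        fix y
        show "measure ?A {x. x $ b + p $ b \<le> q * y $ b} \<le> indicator (M b) y"
        proof (cases "y \<in> M b")
          case True
          then show ?thesis
            using prob_space.prob_le_1[OF lotto_strategyD(1)[OF sA]] by simp
        next
          case False
          have "measure ?A {x. x $ b + p $ b \<le> q * y $ b} \<le> (1 - 1) + 0"
            using False by (intro measure_ramp_strategy_le) (auto simp: ramp_def M_def vec_halfspace_borel split: if_splits)
          with False show ?thesis by simp
        qed
      qed
    qed
    finally show ?thesis .
  qed
  show ?thesis
    using saddle_point[OF sA sB le ge] \<theta> by (intro that[of ?A ?B "\<lambda>b. \<theta> $ b"]) (auto simp: K v_def)
qed

subsection \<open>Optimal pre-allocation\<close>

text \<open>The cost of a constant \<open>\<theta>\<close> involves only the totals of
  \<open>p\<close> and \<open>w\<close>. The cases on \<open>RA\<close> supply the equilibrium that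
  \<open>piA\<close> refers to.\<close>

lemma piA_le_uniform:
  fixes w p :: "real^'n::finite"
  assumes w: "\<forall>b. 0 < w $ b" and q: "0 < q" and RA: "0 \<le> RA" and RB: "0 < RB"
    and p: "p \<in> pre_simplex P" and \<theta>: "0 \<le> \<theta>" "\<theta> \<le> 1" and u: "0 \<le> u" "u = 0 \<longrightarrow> RA = 0"
    and budget: "P * \<theta> + (\<Sum>b\<in>UNIV. w $ b) * \<theta>\<^sup>2 / (2 * u) \<le> q * RB"
  shows "piA q w p RA RB \<le> (\<Sum>b\<in>UNIV. w $ b) * (1 - \<theta>) + RA * u"
proof -
  have p0: "0 \<le> p $ b" for b using p by (simp add: pre_simplex_def)
  have pP: "(\<Sum>b\<in>UNIV. p $ b) = P" using p by (simp add: pre_simplex_def)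
  have budget': "(\<Sum>b\<in>UNIV. p $ b * \<theta> + w $ b * \<theta>\<^sup>2 / (2 * u)) \<le> q * RB"
    using budget pP by (simp add: sum.distrib flip: sum_distrib_right sum_divide_distrib)
  obtain FA FB where NE: "lotto_NE q w p RA RB FA FB"
  proof (cases "RA = 0")
    case True
    then show ?thesis
      using lotto_equilibrium_zero[OF w q p0 RB] that by metis
  next
    case False
    with RA have "0 < RA" by simp
    then show ?thesis
      using lotto_equilibrium_pos[OF w q p0 _ RB] that by metis
  qed
  note B = strategyB_guarantee[where \<theta> = "\<lambda>_. \<theta>", OF w q p0 RA \<theta> u budget']
  show ?thesis
  proof (rule piA_le_payoffA_bound[OF NE B(1)])
    fix FA' :: "(real^'n) measure"
    assume "lotto_strategy RA FA'"
    from B(2)[OF this]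
    show "payoffA q w p FA' (strategyB q w p u (\<lambda>_. \<theta>)) \<le> (\<Sum>b\<in>UNIV. w $ b) * (1 - \<theta>) + RA * u"
      by (simp add: sum_distrib_right)
  qed
qed

section \<open>The closed form of the value\<close>

definition lotto_value :: "real \<Rightarrow> real \<Rightarrow> real \<Rightarrow> real \<Rightarrow> real" where
  "lotto_value W P RA Q =
    (if Q > P \<and> RA < 2 * (Q - P)^2 / (P + 2 * (Q - P))
     then W * (RA / (2 * (Q - P)))
     else W * (1 - Q / (P + RA + sqrt ((RA + P)^2 - P^2))))"

text \<open>When \<open>p\<close> is proportional to \<open>w\<close>, the system collapses to one
  battlefield of value \<open>W\<close> and pre-allocation \<open>P\<close>. The first formula
  arises when the cap at 1 is strictly exceeded, the second when
  \<open>\<theta> = t - P / W * u\<close>.\<close>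

lemma lotto_value_equilibrium:
  fixes W P RA Q t u :: real
  defines "\<theta> \<equiv> capped (P / W) t u"
  assumes W: "0 < W" and P: "0 \<le> P" and RA: "0 < RA" and t: "0 < t" and u: "0 < u"
    and eq1: "W * \<theta>\<^sup>2 = 2 * t * RA * u" and eq2: "t * RA + P * \<theta> = Q"
  shows "W * (1 - \<theta>) + RA * u = lotto_value W P RA Q"
proof -
  have "0 < W * \<theta>\<^sup>2" using eq1 t RA u by simp
  then have \<theta>: "\<theta> \<noteq> 0" "0 < \<theta>" "\<theta> \<le> 1"
    using capped_bounds[of "P / W" t u] by (auto simp: \<theta>_def less_le)
  show ?thesis
  proof (cases "1 < t - P / W * u")
    case True
    then have \<theta>1: "\<theta> = 1" by (simp add: \<theta>_def capped_def)
    define D where "D = Q - P"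
    have D: "D = t * RA" "0 < D" using eq2 t RA by (auto simp: D_def \<theta>1)
    have W_eq: "W = 2 * D * u" using eq1 D by (simp add: \<theta>1)
    have "RA * (P + 2 * D) < 2 * D\<^sup>2"
    proof -
      have *: "P / W * u * (2 * D) = P" using D(2) u by (simp add: W_eq)
      have factor: "(t - a) * (2 * D * RA) = 2 * D * (t * RA) - (a * (2 * D)) * RA" for a
        by (simp add: algebra_simps)
      have "1 * (2 * D * RA) < (t - P / W * u) * (2 * D * RA)"
        using True D(2) RA by (intro mult_strict_right_mono) auto
      also have "\<dots> = 2 * D * (t * RA) - (P / W * u * (2 * D)) * RA"
        by (rule factor)
      also have "\<dots> = 2 * D\<^sup>2 - P * RA"
        unfolding * by (simp add: D(1)[symmetric] power2_eq_square)
      finally show ?thesis by (simp add: algebra_simps)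
    qed
    then have "RA < 2 * D\<^sup>2 / (P + 2 * D)"
      using D P by (simp add: pos_less_divide_eq)
    then have "lotto_value W P RA Q = W * (RA / (2 * D))"
      using D(2) by (simp add: lotto_value_def D_def)
    also have "\<dots> = RA * u" using D(2) by (simp add: W_eq)
    finally show ?thesis by (simp add: \<theta>1)
  next
    case False
    then have \<theta>_eq: "\<theta> = t - P / W * u"
      using \<theta>(1) unfolding \<theta>_def capped_def by linarith
    \<comment> \<open>The upper end of A's bids on the merged battlefield. Eliminating
      \<open>t\<close> and \<open>u\<close> makes it the positive root of
      \<open>M\<^sup>2 = 2 * RA * (M + P)\<close>.\<close>
    define M where "M = W * \<theta> / u"
    have M: "0 < M" using W \<theta> u by (simp add: M_def)
    have u_eq: "u = W * \<theta> / M" using W \<theta> u by (simp add: M_def)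
    have t_eq: "t = \<theta> + P * \<theta> / M" using \<theta>_eq W by (simp add: u_eq)
    have M2: "M\<^sup>2 = 2 * RA * (M + P)"
    proof -
      have "W * \<theta>\<^sup>2 = 2 * (\<theta> + P * \<theta> / M) * RA * (W * \<theta> / M)"
        using eq1 t_eq u_eq by metis
      also have "\<dots> = W * \<theta>\<^sup>2 * (2 * RA * (M + P) / M\<^sup>2)"
        using M by (simp add: field_simps power2_eq_square)
      finally have "W * \<theta>\<^sup>2 * M\<^sup>2 = W * \<theta>\<^sup>2 * (2 * RA * (M + P))"
        using M by (simp add: eq_divide_eq)
      then show ?thesis
        using W \<theta>(1) by simp
    qed
    \<comment> \<open>Selects the sign of the root:
      \<open>sqrt ((M - RA)\<^sup>2) = M - RA\<close>.\<close>
    have "RA \<le> M"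
    proof (rule ccontr)
      assume "\<not> RA \<le> M"
      then have "M * M \<le> RA * M" using M by simp
      moreover have "0 < RA * M" "0 \<le> RA * P" using M RA P by auto
      ultimately show False using M2 by (simp add: power2_eq_square algebra_simps)
    qed
    moreover have "(RA + P)\<^sup>2 - P\<^sup>2 = (M - RA)\<^sup>2"
      using M2 by (simp add: power2_eq_square algebra_simps)
    ultimately have root: "P + RA + sqrt ((RA + P)\<^sup>2 - P\<^sup>2) = P + M" by simp
    have Q_eq: "Q = \<theta> * (RA * (1 + P / M) + P)"
      using eq2 t_eq by (simp add: algebra_simps)
    \<comment> \<open>\<open>D1\<close> is what \<open>Q - P\<close> would be for
      \<open>\<theta> = 1\<close> and the same \<open>M\<close>. It lies on the boundary of the
      regimes, \<open>2 * D1 * (D1 - RA) = RA * P\<close>. As \<open>D \<le> D1\<close> and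
      \<open>x * (x - RA)\<close> increases for \<open>x \<ge> RA\<close>, the strict inequality of
      the first regime is impossible.\<close>
    have "\<not> (Q > P \<and> RA < 2 * (Q - P)\<^sup>2 / (P + 2 * (Q - P)))"
    proof
      assume *: "Q > P \<and> RA < 2 * (Q - P)\<^sup>2 / (P + 2 * (Q - P))"
      define D where "D = Q - P"
      define D1 where "D1 = RA * (1 + P / M)"
      have D: "0 < D" using * by (simp add: D_def)
      have "0 < P + 2 * D" using D P by simp
      moreover have "RA < 2 * D\<^sup>2 / (P + 2 * D)" using * by (simp only: D_def)
      ultimately have "RA * (P + 2 * D) < 2 * D\<^sup>2" by (simp only: pos_less_divide_eq)
      then have lt: "RA * P < 2 * (D * (D - RA))"
        by (simp add: power2_eq_square algebra_simps)
      have "0 \<le> D1 + P" using RA P M by (simp add: D1_def)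
      then have "\<theta> * (D1 + P) \<le> 1 * (D1 + P)"
        using \<theta> by (intro mult_right_mono) auto
      then have D1: "D \<le> D1" by (simp add: D_def D1_def Q_eq)
      have "0 \<le> RA * P" using RA P by simp
      with lt have "0 < D * (D - RA)" by linarith
      then have "0 < D - RA" using D by (simp add: zero_less_mult_iff)
      then have "D * (D - RA) \<le> D1 * (D1 - RA)"
        using D D1 by (intro mult_mono) auto
      also have "\<dots> = RA * P * (RA * (M + P)) / M\<^sup>2"
        using M by (simp add: D1_def field_simps power2_eq_square)
      also have "\<dots> = RA * P / 2"
        using M RA P unfolding M2 mult.assoc[of 2]
        by (intro nonzero_mult_divide_mult_cancel_right) simp
      finally show False using lt by simp
    qed
    then have "lotto_value W P RA Q = W * (1 - Q / (P + M))"
      unfolding lotto_value_def root by auto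
    also have "Q / (P + M) = \<theta> * (1 - RA / M)"
    proof -
      have "Q * M = \<theta> * (RA * M + RA * P + P * M)"
        using M by (simp add: Q_eq field_simps)
      also have "\<dots> = \<theta> * ((M - RA) * (P + M))"
        using M2 by (simp add: power2_eq_square algebra_simps)
      finally show ?thesis
        using M P by (simp add: field_simps)
    qed
    also have "W * (1 - \<theta> * (1 - RA / M)) = W * (1 - \<theta>) + RA * u"
      by (simp add: u_eq algebra_simps)
    finally show ?thesis by simp
  qed
qed

lemma proportional_in_pre_simplex:
  fixes w :: "real^'n::finite"
  assumes "\<forall>b. 0 < w $ b" "0 \<le> P"
  shows "(P / (\<Sum>b\<in>UNIV. w $ b)) *\<^sub>R w \<in> pre_simplex P"
proof -
  define W where "W = (\<Sum>b\<in>UNIV. w $ b)"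
  have W: "0 < W" unfolding W_def using assms by (intro sum_pos) auto
  have "(\<Sum>b\<in>UNIV. ((P / W) *\<^sub>R w) $ b) = P / W * W"
    by (simp only: vector_scaleR_component real_scaleR_def sum_distrib_left W_def)
  then show ?thesis
    using assms W unfolding W_def[symmetric] by (simp add: pre_simplex_def less_imp_le)
qed

text \<open>All ratios of pre-allocation to value equal \<open>P / W\<close>, so
  \<open>capped\<close> returns the same \<open>\<theta>\<close> on every battlefield. The case
  \<open>RA = 0\<close> comes from the knapsack with \<open>u = 0\<close>.\<close>

lemma proportional_equilibrium:
  fixes w :: "real^'n::finite"
  defines "W \<equiv> (\<Sum>b\<in>UNIV. w $ b)"
  assumes w: "\<forall>b. 0 < w $ b" and q: "0 < q" and P: "0 \<le> P" and RA: "0 \<le> RA" and RB: "0 < RB"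
  obtains \<theta> u where "0 \<le> \<theta>" "\<theta> \<le> 1" "0 \<le> u" "u = 0 \<longrightarrow> RA = 0"
    "P * \<theta> + W * \<theta>\<^sup>2 / (2 * u) \<le> q * RB"
    "piA q w ((P / W) *\<^sub>R w) RA RB = W * (1 - \<theta>) + RA * u"
    "W * (1 - \<theta>) + RA * u = lotto_value W P RA (q * RB)"
proof (cases "RA = 0")
  case False
  with RA have RA: "0 < RA" by simp
  have W: "0 < W" unfolding W_def using w by (intro sum_pos) auto
  let ?p = "(P / W) *\<^sub>R w"
  have p: "0 \<le> ?p $ b" for b using w P W by (simp add: less_imp_le)
  have wn: "w $ b \<noteq> 0" for b using w by (metis less_irrefl)
  have ratio: "?p $ b / w $ b = P / W" for b using wn[of b] by simp
  obtain FA FB t u where t: "0 < t" and u: "0 < u" and "lotto_NE q w ?p RA RB FA FB"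
    and eq1: "(\<Sum>b\<in>UNIV. w $ b * (capped (?p $ b / w $ b) t u)\<^sup>2) = 2 * t * RA * u"
    and eq2: "t * RA + (\<Sum>b\<in>UNIV. ?p $ b * capped (?p $ b / w $ b) t u) = q * RB"
    and val: "piA q w ?p RA RB = (\<Sum>b\<in>UNIV. w $ b * (1 - capped (?p $ b / w $ b) t u)) + RA * u"
    by (rule lotto_equilibrium_pos[OF w q p RA RB])
  define \<theta> where "\<theta> = capped (P / W) t u"
  have "(\<Sum>b\<in>UNIV. ?p $ b) = P"
    using proportional_in_pre_simplex[OF w P] by (simp add: pre_simplex_def W_def)
  then have E: "W * \<theta>\<^sup>2 = 2 * t * RA * u" "t * RA + P * \<theta> = q * RB"
      "piA q w ?p RA RB = W * (1 - \<theta>) + RA * u"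
    using eq1 eq2 val unfolding ratio \<theta>_def[symmetric] sum_distrib_right[symmetric]
    by (auto simp: W_def)
  have "W * (1 - \<theta>) + RA * u = lotto_value W P RA (q * RB)"
    using E W P RA t u unfolding \<theta>_def by (intro lotto_value_equilibrium) auto
  with E show ?thesis
    using t u by (intro that[of \<theta> u]) (auto simp: \<theta>_def capped_bounds)
next
  case True
  have W: "0 < W" unfolding W_def using w by (intro sum_pos) auto
  let ?p = "(P / W) *\<^sub>R w"
  have p: "0 \<le> ?p $ b" for b using w P W by (simp add: less_imp_le)
  have simplex: "?p \<in> pre_simplex P"
    unfolding W_def by (rule proportional_in_pre_simplex[OF w P])
  define Q where "Q = q * RB"
  have Q: "0 < Q" using q RB by (simp add: Q_def)
  \<comment> \<open>The largest constant probability that B can afford. As costs are proportional to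
    values, no affordable choice covers more value than \<open>W * \<theta>0\<close>.\<close>
  define \<theta>0 where "\<theta>0 = (if P < Q then 1 else Q / P)"
  have \<theta>0: "0 \<le> \<theta>0" "\<theta>0 \<le> 1" "P * \<theta>0 \<le> Q"
    using P Q by (auto simp: \<theta>0_def field_simps)
  obtain FA FB and \<theta> :: "'n \<Rightarrow> real" where "lotto_NE q w ?p 0 RB FA FB"
    and \<theta>: "\<forall>b. 0 \<le> \<theta> b \<and> \<theta> b \<le> 1"
    and budget: "(\<Sum>b\<in>UNIV. ?p $ b * \<theta> b) \<le> q * RB"
    and val: "piA q w ?p 0 RB = (\<Sum>b\<in>UNIV. w $ b * (1 - \<theta> b))"
    by (rule lotto_equilibrium_zero[OF w q p RB])
  have "piA q w ?p 0 RB = W * (1 - \<theta>0)"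
  proof (rule antisym)
    show "piA q w ?p 0 RB \<le> W * (1 - \<theta>0)"
      using piA_le_uniform[OF w q _ RB simplex \<theta>0(1,2), of 0 0] \<theta>0(3) by (simp add: W_def Q_def)
    have "(\<Sum>b\<in>UNIV. w $ b * \<theta> b) \<le> W * \<theta>0"
    proof (cases "P < Q")
      case True
      have "(\<Sum>b\<in>UNIV. w $ b * \<theta> b) \<le> (\<Sum>b\<in>UNIV. w $ b * 1)"
        using w \<theta> by (intro sum_mono mult_left_mono) (auto simp: less_imp_le)
      with True show ?thesis by (simp add: \<theta>0_def W_def)
    next
      case False
      have "P / W * (\<Sum>b\<in>UNIV. w $ b * \<theta> b) \<le> Q"
        using budget by (simp add: Q_def sum_distrib_left mult_ac)
      with False Q W show ?thesis by (simp add: \<theta>0_def field_simps)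
    qed
    then show "W * (1 - \<theta>0) \<le> piA q w ?p 0 RB"
      unfolding val by (simp add: right_diff_distrib sum_subtractf W_def)
  qed
  moreover have "W * (1 - \<theta>0) = lotto_value W P 0 Q"
    using P by (auto simp: lotto_value_def \<theta>0_def)
  ultimately show ?thesis
    using True \<theta>0 by (intro that[of \<theta>0 0]) (auto simp: Q_def)
qed

theorem theorem1:
  fixes w :: "real^'n::finite" and q P RA RB :: real
  assumes w_pos: "\<forall>b. 0 < w $ b"
    and q_pos: "0 < q" and P_nonneg: "0 \<le> P" and RA_nonneg: "0 \<le> RA" and RB_pos: "0 < RB"
  defines "W \<equiv> (\<Sum>b\<in>UNIV. w $ b)"
  shows "(P / W) *\<^sub>R w \<in> pre_simplex P
       \<and> (\<forall>p \<in> pre_simplex P. piA q w p RA RB \<le> piA q w ((P / W) *\<^sub>R w) RA RB)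
       \<and> piA_star q w P RA RB =
           (if q * RB > P \<and> RA < 2 * (q * RB - P)^2 / (P + 2 * (q * RB - P))
            then W * (RA / (2 * (q * RB - P)))
            else W * (1 - q * RB / (P + RA + sqrt ((RA + P)^2 - P^2))))"
proof -
  let ?p = "(P / W) *\<^sub>R w"
  obtain \<theta> u where \<theta>: "0 \<le> \<theta>" "\<theta> \<le> 1" and u: "0 \<le> u" "u = 0 \<longrightarrow> RA = 0"
    and budget: "P * \<theta> + W * \<theta>\<^sup>2 / (2 * u) \<le> q * RB"
    and val: "piA q w ?p RA RB = W * (1 - \<theta>) + RA * u"
    and eq: "W * (1 - \<theta>) + RA * u = lotto_value W P RA (q * RB)"
    unfolding W_def by (rule proportional_equilibrium[OF w_pos q_pos P_nonneg RA_nonneg RB_pos])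
  have simplex: "?p \<in> pre_simplex P"
    unfolding W_def using w_pos P_nonneg by (rule proportional_in_pre_simplex)
  \<comment> \<open>The pair \<open>\<theta>\<close>, \<open>u\<close> found at \<open>?p\<close>
    stays affordable for B against every pre-allocation of total \<open>P\<close> and concedes no
    more there.\<close>
  have max: "piA q w p RA RB \<le> piA q w ?p RA RB" if "p \<in> pre_simplex P" for p
    unfolding val unfolding W_def
    using budget by (intro piA_le_uniform[OF w_pos q_pos RA_nonneg RB_pos that \<theta> u]) (simp_all add: W_def)
  have "piA_star q w P RA RB = piA q w ?p RA RB"
    unfolding piA_star_def using simplex max by (intro cSup_eq_maximum) auto
  then have "piA_star q w P RA RB = lotto_value W P RA (q * RB)"
    using val eq by simp
  then show ?thesis
    by (intro conjI ballI simplex max) (simp_all only: lotto_value_def)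
qed

end
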